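(* Let $R$ be a transit function on a non-empty finite set $V$ that satisfies Axioms (b2), (J2), (JC), (TW1), (TW2) and (TWC). Then $R=T$ on $G_R$, i.e. $R(u,v)=T(u,v)$ for all $u,v\in V$, where $T$ is the toll walk transit function of the underlying graph $G_R$.
   Context: A transit function on a set $V$ is a map $R:V\times V\to 2^V$ such that for all $u,v\in V$: $u\in R(u,v)$, $R(u,v)=R(v,u)$ and $R(u,u)=\{u\}$. The underlying graph $G_R$ has vertex set $V$, and distinct $u,v$ are adjacent iff $R(u,v)=\{u,v\}$. In a finite simple graph $G$, a walk $W=w_1w_2\cdots w_k$ ($k\ge 2$) is a toll walk if $w_1\neq w_k$, $w_2$ is the only neighbor of $w_1$ among the vertices of $W$, and $w_{k-1}$ is the only neighbor of $w_k$ among the vertices of $W$. The toll walk transit function $T$ of $G$ is given by $T(u,u)=\{u\}$ and, for $u\ne v$, $T(u,v)$ is the set of all vertices lying on some toll walk from $u$ to $v$. The axioms (all quantified over elements of $V$): (b2) If $x\in R(u,v)$, then $R(u,x)\subseteq R(u,v)$. (J2) If $R(u,x)=\{u,x\}$, $R(x,v)=\{x,v\}$, $u\neq v$ and $R(u,v)\neq\{u,v\}$, then $x\in R(u,v)$. (JC) If $u,x,y,v$ are pairwise distinct, $x\in R(u,y)$, $y\in R(x,v)$ and $R(x,y)=\{x,y\}$, then $x\in R(u,v)$. (TW1) If $x,y\in R(u,v)$, $u\neq x$, $x\ne y$, $y\neq v$, $R(x,z)=\{x,z\}$, $R(z,y)=\{z,y\}$, $R(x,v)\neq\{x,v\}$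 and $R(u,y)\neq\{u,y\}$, then $z\in R(u,v)$. (TW2) If $x\in R(u,v)$, $R(u,x)\neq\{u,x\}$, $R(x,v)\neq\{x,v\}$ and $R(x,z)=\{x,z\}$, then $z\in R(u,v)$. (TWC) If $u,v,x$ are pairwise distinct and $x\in R(u,v)$, then there exists $v_1\in R(x,v)$ with $v_1\neq x$, $R(x,v_1)=\{x,v_1\}$, $R(u,v_1)\neq\{u,v_1\}$ and $x\notin R(v_1,v)$. *)

theory Defs
  imports "Graph_Theory.Graph_Theory"
begin

definition transit_function :: "'a set \<Rightarrow> ('a \<Rightarrow> 'a \<Rightarrow> 'a set) \<Rightarrow> bool" where
  "transit_function V R \<longleftrightarrow>
    (\<forall>u\<in>V. \<forall>v\<in>V. R u v \<subseteq> V \<and> u \<in> R u v \<and> R u v = R v u) \<and>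
    (\<forall>u\<in>V. R u u = {u})"

definition underlying_graph :: "'a set \<Rightarrow> ('a \<Rightarrow> 'a \<Rightarrow> 'a set) \<Rightarrow> 'a pair_pre_digraph" where
  "underlying_graph V R =
    \<lparr> pverts = V, parcs = {(u, v). u \<in> V \<and> v \<in> V \<and> u \<noteq> v \<and> R u v = {u, v}} \<rparr>"

text \<open>
  Simple graphs are represented by symmetric loop-free digraphs.  The list \<open>w\<close> of the
  vertices of a walk is indexed from \<open>0\<close>, so \<open>1\<close> is the position of the second vertex and
  \<open>length w - 2\<close> that of the last but one; for \<open>length w = 2\<close> these are the two endpoints.

  The vertices of a walk are counted by position, as in the usual definition of a toll walk:
  \<open>w\<^sub>1\<close> is adjacent to \<open>w\<^sub>i\<close> iff \<open>i = 2\<close>, and \<open>w\<^sub>k\<close> is adjacent to \<open>w\<^sub>i\<close> iff \<open>i = k - 1\<close>.  The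
  neighbour \<open>w\<^sub>2\<close> of \<open>w\<^sub>1\<close> may therefore not be revisited.  Otherwise, in a star with centre
  \<open>c\<close> and leaves \<open>a\<close>, \<open>b\<close>, \<open>d\<close>, the walk \<open>a c d c b\<close> would be a toll walk.
\<close>

definition toll_walk :: "('a, 'b) pre_digraph \<Rightarrow> 'a vwalk \<Rightarrow> bool" where
  "toll_walk G w \<longleftrightarrow>
    vwalk w G \<and> length w \<ge> 2 \<and> hd w \<noteq> last w \<and>
    (\<forall>i<length w. hd w \<rightarrow>\<^bsub>G\<^esub> w ! i \<longleftrightarrow> i = 1) \<and>
    (\<forall>i<length w. last w \<rightarrow>\<^bsub>G\<^esub> w ! i \<longleftrightarrow> i = length w - 2)"

definition toll_walk_transit :: "('a, 'b) pre_digraph \<Rightarrow> 'a \<Rightarrow> 'a \<Rightarrow> 'a set" where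
  "toll_walk_transit G u v =
    (if u = v then {u}
     else {x. \<exists>w. toll_walk G w \<and> hd w = u \<and> last w = v \<and> x \<in> set w})"

definition axiom_b2 :: "'a set \<Rightarrow> ('a \<Rightarrow> 'a \<Rightarrow> 'a set) \<Rightarrow> bool" where
  "axiom_b2 V R \<longleftrightarrow>
    (\<forall>u\<in>V. \<forall>v\<in>V. \<forall>x\<in>V. x \<in> R u v \<longrightarrow> R u x \<subseteq> R u v)"

definition axiom_J2 :: "'a set \<Rightarrow> ('a \<Rightarrow> 'a \<Rightarrow> 'a set) \<Rightarrow> bool" where
  "axiom_J2 V R \<longleftrightarrow>
    (\<forall>u\<in>V. \<forall>v\<in>V. \<forall>x\<in>V.
      R u x = {u, x} \<and> R x v = {x, v} \<and> u \<noteq> v \<and> R u v \<noteq> {u, v} \<longrightarrow> x \<in> R u v)"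

definition axiom_JC :: "'a set \<Rightarrow> ('a \<Rightarrow> 'a \<Rightarrow> 'a set) \<Rightarrow> bool" where
  "axiom_JC V R \<longleftrightarrow>
    (\<forall>u\<in>V. \<forall>v\<in>V. \<forall>x\<in>V. \<forall>y\<in>V.
      distinct [u, x, y, v] \<and> x \<in> R u y \<and> y \<in> R x v \<and> R x y = {x, y} \<longrightarrow> x \<in> R u v)"

definition axiom_TW1 :: "'a set \<Rightarrow> ('a \<Rightarrow> 'a \<Rightarrow> 'a set) \<Rightarrow> bool" where
  "axiom_TW1 V R \<longleftrightarrow>
    (\<forall>u\<in>V. \<forall>v\<in>V. \<forall>x\<in>V. \<forall>y\<in>V. \<forall>z\<in>V.
      x \<in> R u v \<and> y \<in> R u v \<and> u \<noteq> x \<and> x \<noteq> y \<and> y \<noteq> v \<and>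
      R x z = {x, z} \<and> R z y = {z, y} \<and> R x v \<noteq> {x, v} \<and> R u y \<noteq> {u, y} \<longrightarrow>
      z \<in> R u v)"

definition axiom_TW2 :: "'a set \<Rightarrow> ('a \<Rightarrow> 'a \<Rightarrow> 'a set) \<Rightarrow> bool" where
  "axiom_TW2 V R \<longleftrightarrow>
    (\<forall>u\<in>V. \<forall>v\<in>V. \<forall>x\<in>V. \<forall>z\<in>V.
      x \<in> R u v \<and> R u x \<noteq> {u, x} \<and> R x v \<noteq> {x, v} \<and> R x z = {x, z} \<longrightarrow>
      z \<in> R u v)"

definition axiom_TWC :: "'a set \<Rightarrow> ('a \<Rightarrow> 'a \<Rightarrow> 'a set) \<Rightarrow> bool" where
  "axiom_TWC V R \<longleftrightarrow>
    (\<forall>u\<in>V. \<forall>v\<in>V. \<forall>x\<in>V.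
      distinct [u, v, x] \<and> x \<in> R u v \<longrightarrow>
      (\<exists>v\<^sub>1\<in>V. v\<^sub>1 \<in> R x v \<and> v\<^sub>1 \<noteq> x \<and> R x v\<^sub>1 = {x, v\<^sub>1} \<and> R u v\<^sub>1 \<noteq> {u, v\<^sub>1} \<and> x \<notin> R v\<^sub>1 v))"

lemma pair_graph_underlying_graph:
  assumes "transit_function V R" "finite V"
  shows "pair_graph (underlying_graph V R)"
proof -
  have "sym (parcs (underlying_graph V R))"
    using assms(1) unfolding underlying_graph_def transit_function_def
    by (auto intro!: symI)
  moreover have "finite (parcs (underlying_graph V R))"
    by (rule finite_subset[of _ "V \<times> V"]) (auto simp: underlying_graph_def assms(2))
  ultimately show ?thesis
    using assms(2)
    by unfold_locales (auto simp: underlying_graph_def symmetric_def)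
qed

end

theory Submission
  imports Defs
begin

text \<open>
  If \<open>x \<in> R u v\<close> is not an endpoint, then iterating (TWC), with \<open>R x v\<close> shrinking by (b2), gives a
  walk from \<open>x\<close> to \<open>v\<close> that avoids the closed neighbourhood of \<open>u\<close> after \<open>x\<close>; symmetrically there
  is one from \<open>x\<close> to \<open>u\<close>.  Cut at the first neighbours of \<open>v\<close> and \<open>u\<close>, the two walks join to a
  toll walk through \<open>x\<close>.

  Conversely, (J2) and (JC) put every induced path into \<open>R\<close> of its endpoints.  In a toll walk
  \<open>u a \<dots> b v\<close>, take a shortest walk from \<open>a\<close> to \<open>b\<close> with at least one inner vertex, all inner
  vertices coming from the toll walk.  Either it extends to an induced path from \<open>u\<close> to \<open>v\<close>, or
  it has a single inner vertex and \<open>a\<close>, \<open>b\<close> are adjacent, and then (TW1) applies.  In both cases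
  \<open>R u v\<close> contains \<open>a\<close>, \<open>b\<close> and some vertex between them, and (TW2) spreads membership along the
  part of the toll walk that is not adjacent to \<open>u\<close> or \<open>v\<close>.
\<close>

section \<open>Walks and shortest connections for an arbitrary relation\<close>

text \<open>By induction every entry agrees with the head. Later \<open>Q\<close> is membership in
  \<open>R u v\<close>, which (TW2) carries both ways across an edge.\<close>

lemma successively_connected:
  assumes "successively E xs"
    and "\<And>x y. x \<in> set xs \<Longrightarrow> y \<in> set xs \<Longrightarrow> E x y \<Longrightarrow> Q x \<longleftrightarrow> Q y"
    and "x \<in> set xs" "y \<in> set xs"
  shows "Q x \<longleftrightarrow> Q y"
proof -
  have "\<forall>x\<in>set xs. Q x \<longleftrightarrow> Q (hd xs)"
    using assms(1,2)
  proof (induction xs)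
    case (Cons z zs)
    show ?case
    proof (cases "zs = []")
      case False
      then have "E z (hd zs)" "successively E zs"
        using Cons.prems(1) by (auto simp: successively_Cons)
      moreover have "Q z \<longleftrightarrow> Q (hd zs)"
        using Cons.prems(2)[of z "hd zs"] False \<open>E z (hd zs)\<close> by simp
      moreover have "\<forall>x\<in>set zs. Q x \<longleftrightarrow> Q (hd zs)"
        using Cons.IH \<open>successively E zs\<close> Cons.prems(2) by simp
      ultimately show ?thesis by auto
    qed simp
  qed simp
  then show ?thesis
    using assms(3,4) by blast
qed

text \<open>This is weaker than being an induced path: only chords across a single vertex are
  excluded. Hence adding an endpoint creates just one new triple to check, and contiguous sublists
  inherit the property.\<close>

definition shortcut_free :: "('a \<Rightarrow> 'a \<Rightarrow> bool) \<Rightarrow> 'a list \<Rightarrow> bool" where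
  "shortcut_free E xs \<longleftrightarrow>
    distinct xs \<and> successively E xs \<and> (\<forall>p x y z q. xs = p @ x # y # z # q \<longrightarrow> \<not> E x z)"

lemma shortcut_freeD: "shortcut_free E (p @ x # y # z # q) \<Longrightarrow> \<not> E x z"
  unfolding shortcut_free_def by blast

lemma shortcut_free_appendD:
  assumes "shortcut_free E (xs @ ys)"
  shows "shortcut_free E xs" "shortcut_free E ys"
proof -
  have "distinct xs \<and> successively E xs" "distinct ys \<and> successively E ys"
    using assms by (auto simp: shortcut_free_def successively_append_iff)
  moreover have "\<not> E x z" if "xs = p @ x # y # z # q" for p x y z q
    using assms that shortcut_freeD[of E p x y z "q @ ys"] by simp
  moreover have "\<not> E x z" if "ys = p @ x # y # z # q" for p x y z q
    using assms that shortcut_freeD[of E "xs @ p" x y z q] by simp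
  ultimately show "shortcut_free E xs" "shortcut_free E ys"
    unfolding shortcut_free_def by blast+
qed

text \<open>Take \<open>ts\<close> of least length among the nonempty inner parts. A repetition or a
  shortcut would give a shorter candidate. For a single inner vertex the shortcut would leave no
  inner vertex at all, hence the bound \<open>length ts \<ge> 2\<close>.\<close>

lemma shortest_connection:
  assumes "successively E (a # ss @ [b])" "ss \<noteq> []" "a \<notin> set ss" "b \<notin> set ss" "a \<noteq> b"
  obtains ts where "set ts \<subseteq> set ss" "ts \<noteq> []" "successively E (a # ts @ [b])"
    "length ts \<ge> 2 \<Longrightarrow> shortcut_free E (a # ts @ [b])"
proof -
  define P where "P ts \<longleftrightarrow> set ts \<subseteq> set ss \<and> ts \<noteq> [] \<and> successively E (a # ts @ [b])" for ts
  have "P ss"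
    using assms by (simp add: P_def)
  then obtain ts where ts: "P ts" and minimal: "\<And>rs. P rs \<Longrightarrow> length ts \<le> length rs"
    using ex_has_least_nat[of P ss length] by blast
  have walk: "successively E (a # ts @ [b])"
    using ts by (simp add: P_def)
  have "distinct ts"
  proof (rule ccontr)
    assume "\<not> distinct ts"
    then obtain xs ys zs y where eq: "ts = xs @ [y] @ ys @ [y] @ zs"
      using not_distinct_decomp by blast
    have "P (xs @ [y] @ zs)"
      using ts unfolding P_def eq
      by (auto simp: successively_append_iff successively_Cons hd_append)
    \<comment> \<open>Cutting out the loop from \<open>y\<close> to \<open>y\<close> keeps one copy
      of \<open>y\<close>, so the inner part stays nonempty.\<close>
    from minimal[OF this] show False
      by (simp add: eq)
  qed
  have "shortcut_free E (a # ts @ [b])" if "length ts \<ge> 2"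
    unfolding shortcut_free_def
  proof (intro conjI allI impI notI)
    show "distinct (a # ts @ [b])"
      using \<open>distinct ts\<close> ts assms(3-5) by (auto simp: P_def)
    fix p x y z q
    assume eq: "a # ts @ [b] = p @ x # y # z # q" and "E x z"
    \<comment> \<open>The inner part that remains once \<open>y\<close> is deleted. As
      \<open>y\<close> lies strictly between \<open>x\<close> and \<open>z\<close>, the ends are
      still \<open>a\<close> and \<open>b\<close>.\<close>
    define rs where "rs = butlast (tl (p @ x # z # q))"
    have "a # rs @ [b] = p @ x # z # q"
    proof -
      have "hd (p @ x # z # q) = a"
        using eq by (cases p) auto
      moreover have "last (tl (p @ x # z # q)) = b"
        using arg_cong[OF eq, of last] by (cases p) (simp_all split: if_splits)
      moreover have "tl (p @ x # z # q) \<noteq> []"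
        by (cases p) simp_all
      ultimately show ?thesis
        unfolding rs_def
        by (metis append_butlast_last_id append_is_Nil_conv list.collapse list.distinct(1))
    qed
    have "length rs + 1 = length ts"
      using arg_cong[OF eq, of length] arg_cong[OF \<open>a # rs @ [b] = _\<close>, of length] by simp
    have "successively E (a # rs @ [b])"
      using walk \<open>E x z\<close> unfolding eq \<open>a # rs @ [b] = _\<close>
      by (auto simp: successively_append_iff successively_Cons)
    moreover have "set rs \<subseteq> set ts"
    proof -
      have "ts = butlast (tl (p @ x # y # z # q))"
        unfolding eq[symmetric] by simp
      then show ?thesis
        unfolding rs_def by (cases p) (auto simp: butlast_append)
    qed
    ultimately have "P rs"
      using ts \<open>length rs + 1 = length ts\<close> that by (auto simp: P_def)
    from minimal[OF this] show False
      using \<open>length rs + 1 = length ts\<close> by simp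
  qed (rule walk)
  then show thesis
    using that[of ts] ts by (auto simp: P_def)
qed

section \<open>The axioms in terms of adjacency, and induced paths\<close>

locale toll_axioms =
  fixes V :: "'a set" and R :: "'a \<Rightarrow> 'a \<Rightarrow> 'a set"
  assumes finite_V: "finite V"
    and transit: "transit_function V R"
    and b2: "axiom_b2 V R"
    and J2: "axiom_J2 V R"
    and JC: "axiom_JC V R"
    and TW1: "axiom_TW1 V R"
    and TW2: "axiom_TW2 V R"
    and TWC: "axiom_TWC V R"
begin

text \<open>Distinctness is demanded explicitly because \<open>R x x = {x, x}\<close> holds for
  every \<open>x\<close> in \<open>V\<close>.\<close>

definition adj :: "'a \<Rightarrow> 'a \<Rightarrow> bool" where
  "adj x y \<longleftrightarrow> x \<in> V \<and> y \<in> V \<and> x \<noteq> y \<and> R x y = {x, y}"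

lemma R_commute: "u \<in> V \<Longrightarrow> v \<in> V \<Longrightarrow> R u v = R v u"
  using transit by (simp add: transit_function_def)

lemma R_refl [simp]: "u \<in> V \<Longrightarrow> R u u = {u}"
  using transit by (simp add: transit_function_def)

lemma R_subset: "u \<in> V \<Longrightarrow> v \<in> V \<Longrightarrow> R u v \<subseteq> V"
  using transit by (simp add: transit_function_def)

lemma R_left: "u \<in> V \<Longrightarrow> v \<in> V \<Longrightarrow> u \<in> R u v"
  using transit by (simp add: transit_function_def)

lemma R_right: "u \<in> V \<Longrightarrow> v \<in> V \<Longrightarrow> v \<in> R u v"
  using R_commute R_left by blast

lemma adj_commute: "adj x y \<longleftrightarrow> adj y x"
  using R_commute by (auto simp: adj_def)

lemma adj_irrefl [simp]: "\<not> adj x x"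
  by (simp add: adj_def)

lemma adj_in_V: "adj x y \<Longrightarrow> x \<in> V" "adj x y \<Longrightarrow> y \<in> V"
  by (simp_all add: adj_def)

lemma successively_adj_rev: "successively adj (rev xs) \<longleftrightarrow> successively adj xs"
  by (simp add: successively_rev adj_commute[symmetric])

lemma successively_adj_in_V:
  assumes "successively adj xs" "length xs \<ge> 2"
  shows "set xs \<subseteq> V"
  using assms
proof (induction xs rule: induct_list012)
  case (3 x y zs)
  then show ?case
    by (cases zs) (auto dest: adj_in_V)
qed auto

lemma R_b2_left: "u \<in> V \<Longrightarrow> v \<in> V \<Longrightarrow> x \<in> R u v \<Longrightarrow> R u x \<subseteq> R u v"
  using b2 R_subset[of u v] unfolding axiom_b2_def by (meson subsetD)

lemma R_b2_right: "u \<in> V \<Longrightarrow> v \<in> V \<Longrightarrow> x \<in> R u v \<Longrightarrow> R x v \<subseteq> R u v"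
  using R_b2_left[of v u x] R_commute[of u v] R_commute[of x v] R_subset[of u v] by auto

lemma R_J2: "adj u x \<Longrightarrow> adj x v \<Longrightarrow> u \<noteq> v \<Longrightarrow> \<not> adj u v \<Longrightarrow> x \<in> R u v"
  using J2 unfolding axiom_J2_def adj_def by blast

lemma R_JC: "\<lbrakk>distinct [u, x, y, v]; x \<in> R u y; y \<in> R x v; adj x y; u \<in> V; v \<in> V\<rbrakk> \<Longrightarrow> x \<in> R u v"
  using JC unfolding axiom_JC_def adj_def by blast

text \<open>Tailored to the two ends of a toll walk, with \<open>x\<close> next to \<open>u\<close>
  and \<open>y\<close> next to \<open>v\<close>. Since \<open>\<not> adj x v\<close> also holds for
  \<open>x = v\<close>, the inequalities \<open>x \<noteq> v\<close> and \<open>u \<noteq> y\<close>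
  are needed to recover the hypotheses of (TW1).\<close>

lemma R_TW1:
  assumes "x \<in> R u v" "y \<in> R u v" "x \<noteq> y" "adj u x" "adj y v" "adj x z" "adj z y"
    "\<not> adj x v" "\<not> adj u y" "x \<noteq> v" "u \<noteq> y"
  shows "z \<in> R u v"
proof -
  have "u \<in> V" "v \<in> V" "x \<in> V" "y \<in> V" "z \<in> V"
    using assms adj_in_V by blast+
  moreover have "R x v \<noteq> {x, v}" "R u y \<noteq> {u, y}" "u \<noteq> x" "y \<noteq> v"
    "R x z = {x, z}" "R z y = {z, y}"
    using assms by (auto simp: adj_def)
  ultimately show ?thesis
    using TW1 assms(1-3) unfolding axiom_TW1_def by blast
qed

lemma R_TW2:
  assumes "x \<in> R u v" "u \<in> V" "v \<in> V" "u \<noteq> x" "\<not> adj u x" "x \<noteq> v" "\<not> adj x v" "adj x z"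
  shows "z \<in> R u v"
proof -
  have "x \<in> V" "z \<in> V" "R x z = {x, z}"
    using assms(8) by (auto simp: adj_def)
  moreover have "R u x \<noteq> {u, x}" "R x v \<noteq> {x, v}"
    using assms \<open>x \<in> V\<close> by (auto simp: adj_def)
  ultimately show ?thesis
    using TW2 assms(1-3) unfolding axiom_TW2_def by blast
qed

text \<open>
  Only chords that skip a single vertex are excluded here: by (JC) the endpoints of such a
  path of length at least two are then non-adjacent as well, so the underlying graph is chordal.
\<close>

lemma shortcut_free_subset_R:
  assumes "shortcut_free adj xs" "length xs \<ge> 2"
  shows "set xs \<subseteq> R (hd xs) (last xs)"
  using assms
proof (induction "length xs" arbitrary: xs rule: less_induct)
  case less
  have walk: "successively adj xs" and dist: "distinct xs"
    using less.prems(1) by (simp_all add: shortcut_free_def)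
  have "set xs \<subseteq> V"
    using successively_adj_in_V walk less.prems(2) .
  have "xs \<noteq> []"
    using less.prems(2) by auto
  define u v where "u = hd xs" and "v = last xs"
  have uv: "u \<in> V" "v \<in> V"
    using \<open>set xs \<subseteq> V\<close> \<open>xs \<noteq> []\<close> by (auto simp: u_def v_def)
  \<comment> \<open>For consecutive inner vertices, induction applied to the prefix ending in
    \<open>y\<close> and to the suffix starting with \<open>x\<close> yields both premises of
    (JC).\<close>
  have inner: "x \<in> R u v \<and> y \<in> R u v" if xs: "xs = p @ x # y # q" and "p \<noteq> []" "q \<noteq> []" for p x y q
  proof -
    have hl: "hd p = u" "last q = v"
      using xs that by (simp_all add: u_def v_def)
    have sf: "shortcut_free adj (p @ [x, y])" "shortcut_free adj (x # y # q)"
      using less.prems(1) shortcut_free_appendD[of adj "p @ [x, y]" q]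
        shortcut_free_appendD[of adj p "x # y # q"] by (simp_all add: xs)
    have sub: "set (p @ [x, y]) \<subseteq> R (hd (p @ [x, y])) (last (p @ [x, y]))"
      "set (x # y # q) \<subseteq> R (hd (x # y # q)) (last (x # y # q))"
      using less.hyps[OF _ sf(1)] less.hyps[OF _ sf(2)] that by auto
    have x: "x \<in> R u y" and y: "y \<in> R x v"
      using sub that hl by auto
    have "adj x y"
      using walk by (simp add: xs successively_append_iff)
    have "u \<in> set p" "v \<in> set q"
      using hl that(2,3) hd_in_set last_in_set by blast+
    then have d: "distinct [u, x, y, v]"
      using dist xs by auto
    have V: "x \<in> V" "y \<in> V"
      using \<open>adj x y\<close> adj_in_V by blast+
    have "x \<in> R u v"
      using R_JC[OF d x y \<open>adj x y\<close>] uv by simp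
    \<comment> \<open>(JC) only yields its first inner vertex, so it is applied again to the
      reversed path.\<close>
    moreover have "y \<in> R v u"
      using R_JC[of v y x u] d x y \<open>adj x y\<close> uv V R_commute adj_commute by auto
    ultimately show ?thesis
      using R_commute uv by simp
  qed
  show ?case
  proof
    fix w assume "w \<in> set xs"
    then obtain p q where xs: "xs = p @ w # q"
      by (meson split_list)
    \<comment> \<open>Either \<open>w\<close> is an endpoint, or it has an inner successor or an
      inner predecessor, or the path has exactly three vertices. The last case is left to
      (J2).\<close>
    consider "p = []" | "q = []" | "p \<noteq> []" "\<exists>y q'. q = y # q' \<and> q' \<noteq> []"
      | p' x where "p = p' @ [x]" "p' \<noteq> []" "q \<noteq> []" | u' v' where "p = [u']" "q = [v']"
      by (metis append_Nil neq_Nil_conv rev_exhaust)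
    then have "w \<in> R u v"
    proof cases
      case 1
      then show ?thesis using xs uv R_left by (simp add: u_def)
    next
      case 2
      then show ?thesis using xs uv R_right by (simp add: v_def)
    next
      case 3
      then show ?thesis using inner xs by blast
    next
      case 4
      then show ?thesis using inner[of p' x w q] xs by simp
    next
      case 5
      have "\<not> adj u' v'"
        using less.prems(1) shortcut_freeD[of adj "[]" u' w v' "[]"] by (simp add: xs 5)
      moreover have "adj u' w" "adj w v'" "u' \<noteq> v'"
        using walk dist by (auto simp: xs 5)
      ultimately show ?thesis
        using R_J2 by (simp add: u_def v_def xs 5)
    qed
    then show "w \<in> R (hd xs) (last xs)"
      by (simp add: u_def v_def)
  qed
qed

section \<open>Walks that leave the neighbourhood of an endpoint\<close>

text \<open>The vertex \<open>y\<close> supplied by (TWC) satisfies \<open>x \<notin> R y v\<close>,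
  so \<open>R y v\<close> is a proper subset of \<open>R x v\<close> and the cardinality
  decreases.\<close>

lemma escape_walk:
  assumes "x \<in> R u v" "u \<in> V" "v \<in> V" "distinct [u, v, x]"
  shows "\<exists>ws. successively adj (x # ws @ [v]) \<and> (\<forall>w\<in>set (ws @ [v]). \<not> adj u w)"
  using assms
proof (induction "card (R x v)" arbitrary: x rule: less_induct)
  case less
  have x: "x \<in> V"
    using R_subset less.prems by blast
  obtain y where y: "y \<in> V" "y \<in> R x v" "adj x y" "R u y \<noteq> {u, y}" "x \<notin> R y v"
    using TWC less.prems x unfolding axiom_TWC_def adj_def by metis
  \<comment> \<open>As \<open>R u u = {u, u}\<close>, the inequality from (TWC) excludes
    \<open>y = u\<close> too.\<close>
  have "\<not> adj u y" "y \<noteq> u"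
    using y less.prems by (auto simp: adj_def)
  show ?case
  proof (cases "y = v")
    case True
    then show ?thesis
      using y \<open>\<not> adj u y\<close> by (intro exI[of _ "[]"]) auto
  next
    case False
    have "R y v \<subset> R x v"
      using R_b2_right[of x v y] R_left[of x v] y x less.prems by blast
    then have "card (R y v) < card (R x v)"
      using R_subset[of x v] finite_V x less.prems by (meson finite_subset psubset_card_mono)
    moreover have "y \<in> R u v"
      using R_b2_right less.prems y by blast
    ultimately obtain ws where "successively adj (y # ws @ [v])" "\<forall>w\<in>set (ws @ [v]). \<not> adj u w"
      using less.hyps[of y] less.prems \<open>y \<noteq> u\<close> False by auto
    then show ?thesis
      using y \<open>\<not> adj u y\<close> by (intro exI[of _ "y # ws"]) auto
  qed
qed

text \<open>Here \<open>y\<close> is the first neighbour of \<open>v\<close> on the escape walk,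
  possibly \<open>x\<close> itself. The start \<open>x\<close> may be adjacent to \<open>u\<close>,
  hence the \<open>tl\<close>.\<close>

lemma trimmed_escape_walk:
  assumes "x \<in> R u v" "u \<in> V" "v \<in> V" "distinct [u, v, x]"
  obtains ys y where "hd (ys @ [y]) = x" "successively adj (ys @ [y, v])"
    "\<forall>w\<in>set (tl (ys @ [y])). \<not> adj u w" "\<forall>w\<in>set ys. \<not> adj w v"
proof -
  obtain ws where ws: "successively adj (x # ws @ [v])" "\<forall>w\<in>set (ws @ [v]). \<not> adj u w"
    using escape_walk[OF assms] by blast
  have "adj (last (x # ws)) v"
    using ws(1) successively_append_iff[of adj "x # ws" "[v]"] by simp
  then have "\<exists>w\<in>set (x # ws). adj w v"
    using last_in_set[of "x # ws"] by blast
  then obtain ys y zs where split: "x # ws = ys @ y # zs" "adj y v" "\<forall>w\<in>set ys. \<not> adj w v"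
    using split_list_first_prop[of "x # ws" "\<lambda>w. adj w v"] by blast
  have "hd (ys @ [y]) = x"
    using split(1) by (cases ys) auto
  moreover have "successively adj (ys @ y # zs)"
    using ws(1) successively_append_iff[of adj "x # ws" "[v]"] unfolding split(1)[symmetric] by simp
  then have "successively adj (ys @ [y, v])"
    using split(2) by (auto simp: successively_append_iff)
  moreover have "\<forall>w\<in>set (tl (ys @ [y])). \<not> adj u w"
    using ws(2) split(1) by (cases ys) auto
  ultimately show thesis
    using that split(3) by blast
qed

section \<open>Toll walks of the underlying graph\<close>

abbreviation "G \<equiv> with_proj (underlying_graph V R)"

lemma dominates_iff_adj [simp]: "x \<rightarrow>\<^bsub>G\<^esub> y \<longleftrightarrow> adj x y"
  by (auto simp: underlying_graph_def adj_def arcs_ends_def arc_to_ends_def)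

lemma vwalk_iff: "vwalk w G \<longleftrightarrow> w \<noteq> [] \<and> set w \<subseteq> V \<and> successively adj w"
proof -
  have "set (vwalk_arcs w) \<subseteq> arcs_ends G \<longleftrightarrow> successively adj w"
  proof (induction w rule: induct_list012)
    case (3 x y zs)
    then show ?case
      using dominates_iff_adj[of x y] by simp
  qed simp_all
  then show ?thesis
    by (auto simp: vwalk_def underlying_graph_def)
qed

text \<open>Splitting \<open>w\<close> once at its front and once at its back replaces the
  conditions on positions. The splittings may overlap: for a single edge, \<open>a = v\<close> and
  \<open>b = u\<close>.\<close>

lemma toll_walkI:
  assumes "successively adj w" "hd w \<noteq> last w"
    and "w = u # a # t" "\<forall>z\<in>set t. \<not> adj u z"
    and "w = s @ [b, v]" "\<forall>z\<in>set s. \<not> adj z v"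
  shows "toll_walk G w"
  unfolding toll_walk_def dominates_iff_adj
proof (intro conjI allI impI)
  show "vwalk w G"
    using assms(1,3) successively_adj_in_V[OF assms(1)] by (auto simp: vwalk_iff)
  show "2 \<le> length w"
    by (simp add: assms(3))
  fix i assume i: "i < length w"
  show "adj (hd w) (w ! i) \<longleftrightarrow> i = 1"
    using i assms(1,4) unfolding assms(3) by (auto simp: nth_Cons split: nat.splits)
  have "adj b v"
    using assms(1) by (simp add: assms(5) successively_append_iff)
  then show "adj (last w) (w ! i) \<longleftrightarrow> i = length w - 2"
    using i assms(6) adj_commute unfolding assms(5)
    by (auto simp: nth_append nth_Cons split: nat.splits)
qed (rule assms(2))

lemma toll_walkE:
  assumes "toll_walk G w" "hd w = u" "last w = v" "length w \<ge> 3"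
  obtains a t b s where "w = u # a # t" "\<forall>z\<in>set t. \<not> adj u z"
    "w = s @ [b, v]" "\<forall>z\<in>set s. \<not> adj z v" "t \<noteq> []" "s \<noteq> []"
proof -
  have tw: "\<And>i. i < length w \<Longrightarrow> adj u (w ! i) \<longleftrightarrow> i = 1"
    "\<And>i. i < length w \<Longrightarrow> adj v (w ! i) \<longleftrightarrow> i = length w - 2"
    using assms unfolding toll_walk_def dominates_iff_adj by auto
  obtain a t where w1: "w = u # a # t"
    using assms(2,4) by (cases w rule: remdups_adj.cases) auto
  obtain s b where w2: "w = s @ [b, v]"
  proof -
    obtain s' where s': "w = s' @ [v]"
      using assms(3) w1 append_butlast_last_id[of w] by (metis list.distinct(1))
    then have "s' \<noteq> []"
      using w1 by auto
    then have "w = butlast s' @ [last s', v]"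
      by (simp add: s')
    then show thesis using that by blast
  qed
  have "\<forall>z\<in>set t. \<not> adj u z"
  proof
    fix z assume "z \<in> set t"
    then obtain i where "i < length t" "t ! i = z"
      by (auto simp: in_set_conv_nth)
    then show "\<not> adj u z"
      using tw(1)[of "i + 2"] by (simp add: w1)
  qed
  moreover have "\<forall>z\<in>set s. \<not> adj z v"
  proof
    fix z assume "z \<in> set s"
    then obtain i where "i < length s" "s ! i = z"
      by (auto simp: in_set_conv_nth)
    then show "\<not> adj z v"
      using tw(2)[of i] by (simp add: w2 nth_append adj_commute)
  qed
  ultimately show thesis
    using that w1 w2 assms(4) by fastforce
qed

section \<open>From the transit function to toll walks\<close>

lemma R_subset_toll_walk_transit:
  assumes "u \<in> V" "v \<in> V"
  shows "R u v \<subseteq> toll_walk_transit G u v"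
proof
  fix x assume x: "x \<in> R u v"
  show "x \<in> toll_walk_transit G u v"
  proof (cases "u = v")
    case False
    note uv = False
    have "\<exists>w. toll_walk G w \<and> hd w = u \<and> last w = v \<and> x \<in> set w"
    proof (cases "adj u v")
      case True
      then have "toll_walk G [u, v]"
        using uv by (intro toll_walkI[where u = u and a = v and t = "[]" and s = "[]"]) auto
      moreover have "x \<in> {u, v}"
        using x True by (simp add: adj_def)
      ultimately show ?thesis
        by (intro exI[of _ "[u, v]"]) auto
    next
      case nadj: False
      have via: "\<exists>w. toll_walk G w \<and> hd w = u \<and> last w = v \<and> z \<in> set w"
        if z: "z \<in> R u v" "z \<noteq> u" "z \<noteq> v" for z
      proof -
        obtain ys y where P: "hd (ys @ [y]) = z" "successively adj (ys @ [y, v])"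
          "\<forall>w\<in>set (tl (ys @ [y])). \<not> adj u w" "\<forall>w\<in>set ys. \<not> adj w v"
          using trimmed_escape_walk[of z u v] z assms uv by auto
        have "z \<in> R v u"
          using z R_commute assms by simp
        then obtain xs x' where Q: "hd (xs @ [x']) = z" "successively adj (xs @ [x', u])"
          "\<forall>w\<in>set (tl (xs @ [x'])). \<not> adj v w" "\<forall>w\<in>set xs. \<not> adj w u"
          using trimmed_escape_walk[of z v u] z assms uv by auto
        define p q where "p = tl (ys @ [y])" and "q = tl (xs @ [x'])"
        have p: "ys @ [y] = z # p" and q: "xs @ [x'] = z # q"
          using P(1) Q(1) by (metis p_def q_def append_is_Nil_conv list.collapse not_Cons_self2)+
        have rq: "rev q @ [z] = x' # rev xs"
          using arg_cong[OF q, of rev] by simp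
        \<comment> \<open>The walk from \<open>u\<close> to \<open>z\<close> is the reversed trimmed
          walk towards \<open>u\<close>. Read from the front, \<open>x'\<close> is the only
          neighbour of \<open>u\<close>: \<open>rev xs\<close> has none by trimming,
          \<open>p\<close> none by the escape property. Read from the back, the same holds for
          \<open>y\<close> and \<open>v\<close>.\<close>
        define w where "w = u # rev q @ z # p @ [v]"
        have w1: "w = u # x' # (rev xs @ p @ [v])"
          using rq unfolding w_def by (metis append_Cons append_Nil append_assoc)
        have w2: "w = (u # rev q @ ys) @ [y, v]"
          using p unfolding w_def by (metis append_Cons append_Nil append_assoc)
        have "successively adj (z # p @ [v])"
          using P(2) p by (metis append_Cons append_Nil append_assoc)
        moreover have "successively adj (z # q @ [u])"
          using Q(2) q by (metis append_Cons append_Nil append_assoc)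
        then have "successively adj (u # rev q @ [z])"
          using successively_adj_rev[of "z # q @ [u]"] by simp
        ultimately have "successively adj w"
          unfolding w_def using successively_append_iff[of adj "u # rev q @ [z]" "p @ [v]"]
          by (auto simp: successively_append_iff successively_Cons split: if_splits)
        moreover have "\<forall>z\<in>set (rev xs @ p @ [v]). \<not> adj u z"
          using P(3) Q(4) nadj adj_commute by (auto simp: p_def)
        moreover have "\<forall>z\<in>set (u # rev q @ ys). \<not> adj z v"
          using P(4) Q(3) nadj adj_commute by (auto simp: q_def)
        ultimately have "toll_walk G w"
          using w1 w2 uv by (intro toll_walkI[OF _ _ w1 _ w2]) (auto simp: w_def)
        then show ?thesis
          by (intro exI[of _ w]) (auto simp: w_def)
      qed
      \<comment> \<open>The endpoints lie on every toll walk from \<open>u\<close> to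
        \<open>v\<close>, so one such walk suffices; a third element of \<open>R u v\<close>
        provides it.\<close>
      obtain m where "m \<in> R u v" "m \<noteq> u" "m \<noteq> v"
        using nadj uv assms R_left R_right by (fastforce simp: adj_def)
      then obtain w where w: "toll_walk G w" "hd w = u" "last w = v"
        using via by blast
      then have "w \<noteq> []"
        by (auto simp: toll_walk_def)
      then have "u \<in> set w" "v \<in> set w"
        using w hd_in_set last_in_set by blast+
      then show ?thesis
        using via x w by blast
    qed
    then show ?thesis
      using uv by (simp add: toll_walk_transit_def)
  qed (use x assms in \<open>simp add: toll_walk_transit_def\<close>)
qed

section \<open>From toll walks to the transit function\<close>

text \<open>This treats toll walks with at least four vertices. There \<open>a \<noteq> b\<close>,
  because \<open>u\<close> is adjacent to \<open>a\<close> but not to \<open>b\<close>.\<close>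

lemma toll_walk_inner_subset_R:
  assumes walk: "successively adj (u # a # ss @ [b, v])"
    and u: "\<forall>z\<in>set (ss @ [b, v]). \<not> adj u z" and v: "\<forall>z\<in>set (u # a # ss). \<not> adj z v"
    and "u \<noteq> v"
  shows "set (u # a # ss @ [b, v]) \<subseteq> R u v"
proof -
  have "successively adj (a # ss @ [b])" and ua: "adj u a" and bv: "adj b v"
    using walk successively_append_iff[of adj "u # a # ss @ [b]" "[v]"]
    by (auto simp: successively_append_iff successively_Cons)
  have uvV: "u \<in> V" "v \<in> V"
    using ua bv adj_in_V by blast+
  \<comment> \<open>The successor of a second visit to \<open>u\<close> would be a forbidden
    neighbour of \<open>u\<close>. For \<open>v\<close> the predecessor plays this part.\<close>
  have "u \<notin> set ss"
  proof
    assume "u \<in> set ss"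
    then obtain p q where "ss = p @ u # q"
      by (meson split_list)
    then have "adj u (hd (q @ [b]))" "hd (q @ [b]) \<in> set (ss @ [b, v])"
      using walk by (cases q; auto simp: successively_append_iff successively_Cons)+
    then show False
      using u by blast
  qed
  have "v \<notin> set ss"
  proof
    assume "v \<in> set ss"
    then obtain p q where ss: "ss = p @ v # q"
      by (meson split_list)
    then have "successively adj ((a # p) @ v # q @ [b, v])"
      using walk by simp
    then have "adj (last (a # p)) v"
      by (subst (asm) successively_append_iff) simp
    moreover have "last (a # p) \<in> set (u # a # ss)"
      using ss by auto
    ultimately show False
      using v by blast
  qed
  have ne: "a \<notin> set ss" "b \<notin> set ss" "a \<noteq> b" "a \<noteq> v" "u \<noteq> b" "u \<noteq> a" "b \<noteq> v"
    using u v ua bv by auto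
  \<comment> \<open>Adding \<open>u\<close> and \<open>v\<close> creates only the triple that starts
    at \<open>u\<close> and the one that ends at \<open>v\<close>; both are free of chords by the
    toll conditions.\<close>
  have sf: "set (u # a # ts @ [b, v]) \<subseteq> R u v"
    if ts: "set ts \<subseteq> set ss" and s: "shortcut_free adj (a # ts @ [b])" for ts
  proof -
    have "shortcut_free adj (u # a # ts @ [b, v])"
      unfolding shortcut_free_def
    proof (intro conjI allI impI)
      show "distinct (u # a # ts @ [b, v])"
        using s ne \<open>u \<notin> set ss\<close> \<open>v \<notin> set ss\<close> \<open>u \<noteq> v\<close> ts by (auto simp: shortcut_free_def)
      have "successively adj (a # ts @ [b])"
        using s by (simp add: shortcut_free_def)
      then show "successively adj (u # a # ts @ [b, v])"
        using ua bv successively_append_iff[of adj "a # ts @ [b]" "[v]"] by simp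
      fix p x y z q
      assume eq: "u # a # ts @ [b, v] = p @ x # y # z # q"
      show "\<not> adj x z"
      proof (cases "p = []")
        case True
        then have "x = u" "z \<in> set (ts @ [b, v])"
          using eq by (cases ts; auto)+
        then show ?thesis
          using u ts by auto
      next
        case p: False
        show ?thesis
        \<comment> \<open>For empty \<open>q\<close> the triple ends at \<open>v\<close>; otherwise
          it lies within \<open>a # ts @ [b]\<close>.\<close>
        proof (cases q rule: rev_cases)
          case Nil
          then have "(u # a # ts) @ [b, v] = (p @ [x]) @ [y, z]"
            using eq by simp
          then have "p @ [x] = u # a # ts" "z = v"
            by (subst (asm) append_eq_append_conv; simp)+
          then have "z = v" "x \<in> set (u # a # ts)"
            by (metis, metis in_set_conv_decomp)
          then show ?thesis
            using v ts by auto
        next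
          case (snoc q' v')
          obtain u' p' where "p = u' # p'"
            using p by (cases p) auto
          then have "(a # ts @ [b]) @ [v] = (p' @ x # y # z # q') @ [v']"
            using eq snoc by simp
          then have "a # ts @ [b] = p' @ x # y # z # q'"
            by (subst (asm) append_eq_append_conv) simp_all
          then show ?thesis
            using s shortcut_freeD by metis
        qed
      qed
    qed
    from shortcut_free_subset_R[OF this] show ?thesis
      by simp
  qed
  show ?thesis
  proof (cases "ss = []")
    case True
    then have "shortcut_free adj (a # [] @ [b])"
      using \<open>successively adj (a # ss @ [b])\<close> ne by (auto simp: shortcut_free_def Cons_eq_append_conv)
    then show ?thesis
      using sf[of "[]"] True by simp
  next
    case False
    obtain ts where ts: "set ts \<subseteq> set ss" "ts \<noteq> []" "successively adj (a # ts @ [b])"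
      "length ts \<ge> 2 \<Longrightarrow> shortcut_free adj (a # ts @ [b])"
      using shortest_connection[OF \<open>successively adj (a # ss @ [b])\<close> False ne(1-3)] by blast
    have "a \<in> R u v \<and> b \<in> R u v \<and> hd ts \<in> R u v"
    proof (cases "shortcut_free adj (a # ts @ [b])")
      case True
      then show ?thesis
        using sf[OF ts(1)] ts(2) hd_in_set[of ts] by auto
    next
      case False
      then have "length ts = 1"
        using ts(2,4) by (cases ts) (auto simp: Suc_le_eq)
      then obtain z where z: "ts = [z]"
        by (auto simp: length_Suc_conv)
      have "adj a z" "adj z b"
        using ts(3) by (simp_all add: z)
      \<comment> \<open>With a single inner vertex, the chord from \<open>a\<close> to
        \<open>b\<close> is the only possible defect. It makes \<open>u\<close>, \<open>a\<close>,
        \<open>b\<close>, \<open>v\<close> a shortcut-free path, which puts \<open>a\<close> and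
        \<open>b\<close> into \<open>R u v\<close>, as (TW1) requires.\<close>
      have "adj a b"
        using False ts(1,3) ne by (auto simp: z shortcut_free_def Cons_eq_append_conv)
      then have "shortcut_free adj (a # [] @ [b])"
        using ne by (auto simp: shortcut_free_def Cons_eq_append_conv)
      then have ab: "a \<in> R u v" "b \<in> R u v"
        using sf[of "[]"] by auto
      moreover have "z \<in> R u v"
        using R_TW1[OF ab _ ua bv \<open>adj a z\<close> \<open>adj z b\<close>] u v ne by auto
      ultimately show ?thesis
        by (simp add: z)
    qed
    moreover have "z \<in> R u v" if "z \<in> set ss" for z
    proof -
      have "successively adj ss"
        using \<open>successively adj (a # ss @ [b])\<close> by (auto simp: successively_append_iff successively_Cons)
      \<comment> \<open>Vertices of \<open>ss\<close> are neither equal nor adjacent to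
        \<open>u\<close> or \<open>v\<close>, so (TW2) applies from either end of the edge.\<close>
      moreover have "x \<in> R u v \<longleftrightarrow> y \<in> R u v" if "x \<in> set ss" "y \<in> set ss" "adj x y" for x y
        using that R_TW2[of x u v y] R_TW2[of y u v x] uvV u v \<open>u \<notin> set ss\<close> \<open>v \<notin> set ss\<close> adj_commute
        by (auto 4 3)
      moreover have "hd ts \<in> set ss"
        using ts(1,2) hd_in_set by blast
      ultimately have "z \<in> R u v \<longleftrightarrow> hd ts \<in> R u v"
        using successively_connected[of adj ss "\<lambda>x. x \<in> R u v" z "hd ts"] that by blast
      then show ?thesis
        using \<open>_ \<and> _ \<and> hd ts \<in> R u v\<close> by blast
    qed
    ultimately show ?thesis
      using R_left[OF uvV] R_right[OF uvV] by auto
  qed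
qed

lemma toll_walk_subset_R:
  assumes "toll_walk G w" "hd w = u" "last w = v"
  shows "set w \<subseteq> R u v"
proof -
  have w: "set w \<subseteq> V" "successively adj w" "length w \<ge> 2" "u \<noteq> v" "w \<noteq> []"
  proof -
    have "vwalk w G \<and> length w \<ge> 2 \<and> hd w \<noteq> last w"
      using assms(1) unfolding toll_walk_def by (elim conjE) (intro conjI)
    then show "set w \<subseteq> V" "successively adj w" "length w \<ge> 2" "u \<noteq> v" "w \<noteq> []"
      using assms(2,3) by (simp_all add: vwalk_iff)
  qed
  have uvV: "u \<in> V" "v \<in> V"
    using assms(2,3) w(1,5) by auto
  show ?thesis
  proof (cases "length w = 2")
    case True
    then have "w = [u, v]"
      using assms(2,3) by (auto simp: numeral_2_eq_2 length_Suc_conv)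
    then show ?thesis
      using R_left R_right uvV by simp
  next
    case False
    then have "length w \<ge> 3"
      using w(3) by simp
    then obtain a t b s where split: "w = u # a # t" "\<forall>z\<in>set t. \<not> adj u z"
      "w = s @ [b, v]" "\<forall>z\<in>set s. \<not> adj z v" "t \<noteq> []" "s \<noteq> []"
      using toll_walkE[OF assms] by metis
    obtain s' where s: "s = u # s'"
      using split by (cases s) auto
    have eq: "a # t = s' @ [b, v]"
      using split(1,3) s by simp
    show ?thesis
    proof (cases s')
      case Nil
      \<comment> \<open>The walk is \<open>u\<close>, \<open>a\<close>, \<open>v\<close>, whose
        middle vertex is both second and last but one.\<close>
      then have "t = [v]" "a = b"
        using eq by auto
      then have "a \<in> R u v"
        using w(2,4) split(1,2) R_J2 by simp
      then show ?thesis
        using R_left R_right uvV by (simp add: split(1) \<open>t = [v]\<close>)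
    next
      case (Cons c ss)
      then have "t = ss @ [b, v]" "s = u # a # ss"
        using eq s by auto
      then show ?thesis
        using toll_walk_inner_subset_R[of u a ss b v] split w(2,4) by simp
    qed
  qed
qed

end

theorem theorem4:
  fixes V :: "'a set" and R :: "'a \<Rightarrow> 'a \<Rightarrow> 'a set"
  assumes "finite V" and "V \<noteq> {}"
    and "transit_function V R"
    and "axiom_b2 V R"
    and "axiom_J2 V R"
    and "axiom_JC V R"
    and "axiom_TW1 V R"
    and "axiom_TW2 V R"
    and "axiom_TWC V R"
  shows "\<forall>u\<in>V. \<forall>v\<in>V.
    R u v = toll_walk_transit (with_proj (underlying_graph V R)) u v"
proof (intro ballI)
  interpret toll_axioms V R
    using assms by unfold_locales
  fix u v assume "u \<in> V" "v \<in> V"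
  moreover have "toll_walk_transit G u v \<subseteq> R u v"
    using toll_walk_subset_R \<open>u \<in> V\<close> by (auto simp: toll_walk_transit_def)
  ultimately show "R u v = toll_walk_transit G u v"
    using R_subset_toll_walk_transit by blast
qed

end
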